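(* Let $K$ be a field, $H$ a free abelian group of finite rank, and $\alpha:H\times H\to K^*$ a map with $\alpha(h,g)=\alpha(g,h)^{-1}$ and $\alpha(h_1+h_2,g)=\alpha(h_1,g)\alpha(h_2,g)$. Denote by $1$ the trivial pairing $H\times H\to K^*$, and mark elements of $\mathcal G(H,1)$ and $\mathcal G(H,\alpha)$ by subscripts $1$ and $\alpha$. Then: (a) The map written in terms of left representatives $$u_{1,\alpha}:\mathcal G(H,1)\to\mathcal G(H,\alpha):\quad [c;x,h,0]_1\mapsto[c;xA_h,h,0]_\alpha$$ is a group isomorphism. (b) The linear map (denoted by the same symbol) $$u_{1,\alpha}:Al(H,1)\to Al(H,\alpha):\quad e_{H,1}(h)\mapsto e_{H,\alpha}(h)$$ is an isomorphism of representations extending the group isomorphism of (a), i.e. $u_{1,\alpha}(\Gamma\Phi)=u_{1,\alpha}(\Gamma)\,u_{1,\alpha}(\Phi)$ for all $\Gamma\in\mathcal G(H,1)$, $\Phi\in Al(H,1)$; and similarly for the other spaces of functions, i.e. for $Af$, and for $An$ when $K$ is a complete normed field and $\alpha$ is unitary (with $\sum a_he_{H,1}(h)\mapsto\sum a_he_{H,\alpha}(h)$). (c) The map in (a) is the unique group isomorphism $\mathcal G(H,1)\to\mathcal G(H,\alpha)$ satisfying (b).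
   Context: $T(H,1)(K):=\mathrm{Hom}(H,K^* )$, written multiplicatively; for $x\in T(H,1)(K)$ and $h\in H$, $h(x)\in K^*$ denotes the value of $x$ at $h$. For $h\in H$, the point $A_h\in T(H,1)(K)$ is defined by $g(A_h)=\alpha(g,h)$ for all $g\in H$. $Al(H,\alpha)$ is the $K$-algebra with $K$-basis $e(h)=e_{H,\alpha}(h)$, $h\in H$, and multiplication $e(h)e(h')=\alpha(h,h')e(h+h')$; each $e(h)$ is invertible. $Af(H,\alpha)$ is the $K$-space of all formal infinite linear combinations $\sum_{h\in H}a_he(h)$; it is a two-sided $Al(H,\alpha)$-module. When $K$ is a complete normed field (with multiplicative absolute value $|\cdot|$) and $\alpha$ is unitary, i.e. $|\alpha(g,h)|=1$ for all $g,h$, the space $An(H,\alpha)$ consists of the formal functions $\sum a_he(h)$ with $|a_h|\,N^{\|h\|}\to 0$ as $\|h\|\to\infty$ for every $N>0$, $\|\cdot\|$ being any Euclidean norm on $H$. The shift by $x\in T(H,1)(K)$ is $x^*\left(\sum a_he(h)\right)=\sum a_h\,h(x)\,e(h)$. $\widetilde{\mathcal G}(H,\alpha)$ is the group of quadruples $[c;x,g,h]$ ($c\in K^*$, $x\in T(H,1)(K)$, $g,h\in H$) with multiplication $$[c';x',g',h']\cdot[c;x,g,h]=[c'c\,g(x')\,h(x')^{-1}\alpha(g',g)\,\alpha(h',h)^{-1};\,xx',\,g+g',\,h+h'],$$ acting on function spaces by $\Phi\mapsto c\,e(g)\,x^*(\Phi)\,e(h)^{-1}$. Its central subgroup $\widetilde{\mathcal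 G}_0(H,\alpha)=\{[1;A_h^2,h,h]\mid h\in H\}$ is the kernel of this action, and the large Heisenberg group is $\mathcal G(H,\alpha)=\widetilde{\mathcal G}(H,\alpha)/\widetilde{\mathcal G}_0(H,\alpha)$. Every element of $\mathcal G(H,\alpha)$ is the class of a unique element of the form $[c;x,h,0]$, called its left representative. *)

theory Defs
  imports "HOL-Analysis.Analysis" "HOL-Algebra.Free_Abelian_Groups" "HOL-Algebra.Ring"
begin

text \<open>
  The group \<open>H\<close> is the additive group of a type \<open>'h\<close> of class \<^class>\<open>ab_group_add\<close>, and the field
  \<open>K\<close> is a type \<open>'k\<close> of class \<^class>\<open>field\<close>.
\<close>

definition add_grp :: "'h::ab_group_add monoid"
  where "add_grp = \<lparr>carrier = UNIV, monoid.mult = (+), one = 0\<rparr>"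

definition free_abelian_finite_rank :: "'h::ab_group_add itself \<Rightarrow> bool"
  where "free_abelian_finite_rank _ \<longleftrightarrow>
    (\<exists>n::nat. (add_grp :: 'h monoid) \<cong> free_Abelian_group {..<n})"

definition alt_pairing :: "('h::ab_group_add \<Rightarrow> 'h \<Rightarrow> 'k::field) \<Rightarrow> bool"
  where "alt_pairing \<alpha> \<longleftrightarrow>
    (\<forall>g h. \<alpha> g h \<noteq> 0) \<and>
    (\<forall>g h. \<alpha> h g = inverse (\<alpha> g h)) \<and>
    (\<forall>h1 h2 g. \<alpha> (h1 + h2) g = \<alpha> h1 g * \<alpha> h2 g)"

definition triv :: "'h::ab_group_add \<Rightarrow> 'h \<Rightarrow> 'k::field"
  where "triv = (\<lambda>_ _. 1)"

text \<open>\<open>T(H,1)(K) = Hom(H, K\<^sup>*)\<close>; the value \<open>h(x)\<close> is the application \<open>x h\<close>.\<close>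

definition torus :: "('h::ab_group_add \<Rightarrow> 'k::field) set"
  where "torus = {x. (\<forall>h. x h \<noteq> 0) \<and> (\<forall>g h. x (g + h) = x g * x h)}"

definition A_pt :: "('h::ab_group_add \<Rightarrow> 'h \<Rightarrow> 'k::field) \<Rightarrow> 'h \<Rightarrow> 'h \<Rightarrow> 'k"
  where "A_pt \<alpha> h = (\<lambda>g. \<alpha> g h)"


subsection \<open>Spaces of functions\<close>

text \<open>
  A formal linear combination \<open>\<Sum> a\<^sub>h e(h)\<close> is represented by its coefficient function
  \<open>h \<mapsto> a\<^sub>h\<close>.  In this representation the underlying \<open>K\<close>-spaces and the basis elements \<open>e(h)\<close> are the
  same for all pairings; the pairing enters only through the multiplications.
\<close>

definition e_basis :: "'h::ab_group_add \<Rightarrow> 'h \<Rightarrow> 'k::field"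
  where "e_basis h = (\<lambda>k. if k = h then 1 else 0)"

definition Al_space :: "('h::ab_group_add \<Rightarrow> 'k::field) set"
  where "Al_space = {\<Phi>. finite {h. \<Phi> h \<noteq> 0}}"

definition Af_space :: "('h::ab_group_add \<Rightarrow> 'k::field) set"
  where "Af_space = UNIV"

text \<open>
  Left and right multiplication by \<open>\<phi> \<in> Al(H,\<alpha>)\<close>, obtained by extending
  \<open>e(g) e(h) = \<alpha>(g,h) e(g+h)\<close>; they are meaningful only if \<open>\<phi>\<close> has finite support,
  while \<open>\<Psi>\<close> is arbitrary.
\<close>

definition lmul :: "('h::ab_group_add \<Rightarrow> 'h \<Rightarrow> 'k::field) \<Rightarrow> ('h \<Rightarrow> 'k) \<Rightarrow> ('h \<Rightarrow> 'k) \<Rightarrow> 'h \<Rightarrow> 'k"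
  where "lmul \<alpha> \<phi> \<Psi> = (\<lambda>k. \<Sum>g | \<phi> g \<noteq> 0. \<phi> g * \<Psi> (k - g) * \<alpha> g (k - g))"

definition rmul :: "('h::ab_group_add \<Rightarrow> 'h \<Rightarrow> 'k::field) \<Rightarrow> ('h \<Rightarrow> 'k) \<Rightarrow> ('h \<Rightarrow> 'k) \<Rightarrow> 'h \<Rightarrow> 'k"
  where "rmul \<alpha> \<Psi> \<phi> = (\<lambda>k. \<Sum>h | \<phi> h \<noteq> 0. \<Psi> (k - h) * \<phi> h * \<alpha> (k - h) h)"

text \<open>The unit is \<open>e(0)\<close>, because \<open>\<alpha>(0,h) = \<alpha>(h,0) = 1\<close>.\<close>

definition Al :: "('h::ab_group_add \<Rightarrow> 'h \<Rightarrow> 'k::field) \<Rightarrow> ('h \<Rightarrow> 'k) ring"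
  where "Al \<alpha> = \<lparr>carrier = Al_space, monoid.mult = lmul \<alpha>, one = e_basis 0,
                 ring.zero = (\<lambda>_. 0), ring.add = (\<lambda>\<Phi> \<Psi> h. \<Phi> h + \<Psi> h)\<rparr>"

definition shift :: "('h::ab_group_add \<Rightarrow> 'k::field) \<Rightarrow> ('h \<Rightarrow> 'k) \<Rightarrow> 'h \<Rightarrow> 'k"
  where "shift x \<Phi> = (\<lambda>h. \<Phi> h * x h)"

definition complete_abs_value :: "('k::field \<Rightarrow> real) \<Rightarrow> bool"
  where "complete_abs_value v \<longleftrightarrow>
    (\<forall>a. 0 \<le> v a) \<and> (\<forall>a. v a = 0 \<longleftrightarrow> a = 0) \<and>
    (\<forall>a b. v (a * b) = v a * v b) \<and> (\<forall>a b. v (a + b) \<le> v a + v b) \<and>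
    Metric_space.mcomplete UNIV (\<lambda>a b. v (a - b))"

definition unitary_pairing :: "('k::field \<Rightarrow> real) \<Rightarrow> ('h::ab_group_add \<Rightarrow> 'h \<Rightarrow> 'k) \<Rightarrow> bool"
  where "unitary_pairing v \<alpha> \<longleftrightarrow> (\<forall>g h. v (\<alpha> g h) = 1)"

text \<open>
  A Euclidean norm on \<open>H\<close> is the restriction of a Euclidean norm on \<open>H \<otimes> \<real>\<close>.  Positive definiteness
  of the Gram matrix \<open>Q\<close> is required for all real vectors, which is stronger than positivity of
  the form on the nonzero elements of \<open>H\<close>.
\<close>

definition euclidean_norm_on :: "('h::ab_group_add \<Rightarrow> real) \<Rightarrow> bool"
  where "euclidean_norm_on nm \<longleftrightarrow>
    (\<exists>(n::nat) \<theta> (Q :: nat \<Rightarrow> nat \<Rightarrow> real).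
       \<theta> \<in> iso (add_grp :: 'h monoid) (free_Abelian_group {..<n}) \<and>
       (\<forall>i<n. \<forall>j<n. Q i j = Q j i) \<and>
       (\<forall>w :: nat \<Rightarrow> real. (\<exists>i<n. w i \<noteq> 0) \<longrightarrow> (\<Sum>i<n. \<Sum>j<n. Q i j * w i * w j) > 0) \<and>
       (\<forall>h. nm h = sqrt (\<Sum>i<n. \<Sum>j<n.
          Q i j * real_of_int (Poly_Mapping.lookup (\<theta> h) i)
                * real_of_int (Poly_Mapping.lookup (\<theta> h) j))))"

definition An_space :: "('k::field \<Rightarrow> real) \<Rightarrow> ('h::ab_group_add \<Rightarrow> real) \<Rightarrow> ('h \<Rightarrow> 'k) set"
  where "An_space v nm =
    {\<Phi>. \<forall>N>0. ((\<lambda>h. v (\<Phi> h) * N powr nm h) \<longlongrightarrow> 0) (filtercomap nm at_top)}"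


subsection \<open>The large Heisenberg group and its action\<close>

type_synonym ('h, 'k) quad = "'k \<times> ('h \<Rightarrow> 'k) \<times> 'h \<times> 'h"

definition heis_tilde :: "('h::ab_group_add \<Rightarrow> 'h \<Rightarrow> 'k::field) \<Rightarrow> ('h, 'k) quad monoid"
  where "heis_tilde \<alpha> =
    \<lparr>carrier = {(c, x, g, h). c \<noteq> 0 \<and> x \<in> torus},
     monoid.mult = (\<lambda>(c', x', g', h') (c, x, g, h).
       (c' * c * x' g * inverse (x' h) * \<alpha> g' g * inverse (\<alpha> h' h),
        (\<lambda>k. x k * x' k), g + g', h + h')),
     one = (1, (\<lambda>_. 1), 0, 0)\<rparr>"

definition heis_tilde0 :: "('h::ab_group_add \<Rightarrow> 'h \<Rightarrow> 'k::field) \<Rightarrow> ('h, 'k) quad set"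
  where "heis_tilde0 \<alpha> = {(1, (\<lambda>g. (A_pt \<alpha> h g)\<^sup>2), h, h) | h. True}"

definition heis :: "('h::ab_group_add \<Rightarrow> 'h \<Rightarrow> 'k::field) \<Rightarrow> ('h, 'k) quad set monoid"
  where "heis \<alpha> = heis_tilde \<alpha> Mod heis_tilde0 \<alpha>"

definition heis_class :: "('h::ab_group_add \<Rightarrow> 'h \<Rightarrow> 'k::field) \<Rightarrow> ('h, 'k) quad \<Rightarrow> ('h, 'k) quad set"
  where "heis_class \<alpha> \<gamma> = heis_tilde0 \<alpha> #>\<^bsub>heis_tilde \<alpha>\<^esub> \<gamma>"

definition heis_tilde_act ::
    "('h::ab_group_add \<Rightarrow> 'h \<Rightarrow> 'k::field) \<Rightarrow> ('h, 'k) quad \<Rightarrow> ('h \<Rightarrow> 'k) \<Rightarrow> 'h \<Rightarrow> 'k"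
  where "heis_tilde_act \<alpha> = (\<lambda>(c, x, g, h) \<Phi>.
    (\<lambda>k. c * rmul \<alpha> (lmul \<alpha> (e_basis g) (shift x \<Phi>)) (inv\<^bsub>Al \<alpha>\<^esub> (e_basis h)) k))"

text \<open>
  All representatives of a class act in the same way, so the image below is a singleton.
\<close>

definition heis_act ::
    "('h::ab_group_add \<Rightarrow> 'h \<Rightarrow> 'k::field) \<Rightarrow> ('h, 'k) quad set \<Rightarrow> ('h \<Rightarrow> 'k) \<Rightarrow> 'h \<Rightarrow> 'k"
  where "heis_act \<alpha> \<Gamma> \<Phi> = the_elem ((\<lambda>\<gamma>. heis_tilde_act \<alpha> \<gamma> \<Phi>) ` \<Gamma>)"


subsection \<open>The maps from the trivial pairing to a general one\<close>

definition u_grp ::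
    "('h::ab_group_add \<Rightarrow> 'h \<Rightarrow> 'k::field) \<Rightarrow> ('h, 'k) quad set \<Rightarrow> ('h, 'k) quad set"
  where "u_grp \<alpha> \<Gamma> = (THE \<Delta>. \<exists>c x h. c \<noteq> 0 \<and> x \<in> torus \<and>
    \<Gamma> = heis_class triv (c, x, h, 0) \<and>
    \<Delta> = heis_class \<alpha> (c, (\<lambda>g. x g * A_pt \<alpha> h g), h, 0))"

text \<open>
  \<open>\<Sum> a\<^sub>h e\<^sub>1(h) \<mapsto> \<Sum> a\<^sub>h e\<^sub>\<alpha>(h)\<close>, which on coefficient functions is the identity.
\<close>

definition u_fun :: "('h::ab_group_add \<Rightarrow> 'k::field) \<Rightarrow> 'h \<Rightarrow> 'k"
  where "u_fun \<Phi> = (\<lambda>h. \<Phi> h)"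

definition lin_iso_on ::
    "('h \<Rightarrow> 'k::field) set \<Rightarrow> ('h \<Rightarrow> 'k) set \<Rightarrow> (('h \<Rightarrow> 'k) \<Rightarrow> 'h \<Rightarrow> 'k) \<Rightarrow> bool"
  where "lin_iso_on V W u \<longleftrightarrow> bij_betw u V W \<and>
    (\<forall>\<Phi>\<in>V. \<forall>\<Psi>\<in>V. u (\<lambda>h. \<Phi> h + \<Psi> h) = (\<lambda>h. u \<Phi> h + u \<Psi> h)) \<and>
    (\<forall>a. \<forall>\<Phi>\<in>V. u (\<lambda>h. a * \<Phi> h) = (\<lambda>h. a * u \<Phi> h))"

definition intertwines ::
    "('h::ab_group_add \<Rightarrow> 'h \<Rightarrow> 'k::field) \<Rightarrow> ('h \<Rightarrow> 'k) set \<Rightarrow>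
     (('h, 'k) quad set \<Rightarrow> ('h, 'k) quad set) \<Rightarrow> (('h \<Rightarrow> 'k) \<Rightarrow> 'h \<Rightarrow> 'k) \<Rightarrow> bool"
  where "intertwines \<alpha> V f u \<longleftrightarrow>
    (\<forall>\<Gamma>\<in>carrier (heis triv). \<forall>\<Phi>\<in>V. u (heis_act triv \<Gamma> \<Phi>) = heis_act \<alpha> (f \<Gamma>) (u \<Phi>))"

end

theory Submission
  imports Defs
begin

text \<open>
  The two Heisenberg groups act on the same space of coefficient functions, and on left
  representatives the action is
  \<open>[c;x,h,0] \<cdot> e(m) = c x(m) \<alpha>(h,m) e(h+m)\<close>.  Since \<open>A\<^sub>h(m) \<alpha>(h,m) = \<alpha>(m,h) \<alpha>(h,m) = 1\<close>,
  replacing \<open>x\<close> by \<open>x A\<^sub>h\<close> cancels the factor \<open>\<alpha>(h,m)\<close>: the elements \<open>[c;x,h,0]\<^sub>1\<close> and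
  \<open>[c;x A\<^sub>h,h,0]\<^sub>\<alpha>\<close> are the same operator.  This is the intertwining property, and it holds for one
  coefficient function at a time, so it does not depend on the space of functions (lemma
  \<open>u_grp_intertwines\<close>).

  The same cancellation in the group law, where
  \<open>[c';x',g',0] [c;x,g,0] = [c' c x'(g) \<alpha>(g',g); x x', g+g', 0]\<close>, shows that the map is
  multiplicative; it is bijective because left representatives exist and are unique and \<open>x \<mapsto> x A\<^sub>h\<close>
  is a bijection of the torus.  Uniqueness in (c) expresses that the action on \<open>Al\<close> is faithful
  (lemma \<open>heis_act_faithful\<close>): the image of \<open>e(0)\<close> determines \<open>h\<close> and \<open>c\<close>, and then the images of
  the other \<open>e(m)\<close> determine \<open>x\<close>.

  The hypotheses only give \<open>\<alpha>(h,h) = \<plusminus>1\<close>.  The sign enters through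
  \<open>e(h)\<^sup>-\<^sup>1 = \<alpha>(h,h) e(-h)\<close>, and it cancels in the formula for the action.
\<close>

section \<open>Alternating pairings\<close>

locale alternating_pairing =
  fixes \<alpha> :: "'h::ab_group_add \<Rightarrow> 'h \<Rightarrow> 'k::field"
  assumes alt: "alt_pairing \<alpha>"
begin

lemma nonzero [simp]: "\<alpha> g h \<noteq> 0"
  by (rule alt[unfolded alt_pairing_def, THEN conjunct1, rule_format])

lemma skew: "\<alpha> h g = inverse (\<alpha> g h)"
  by (rule alt[unfolded alt_pairing_def, THEN conjunct2, THEN conjunct1, rule_format])

lemma skew_mult [simp]: "\<alpha> g h * \<alpha> h g = 1"
  by (simp add: skew[of h g])

lemma add_left: "\<alpha> (g + g') h = \<alpha> g h * \<alpha> g' h"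
  by (rule alt[unfolded alt_pairing_def, THEN conjunct2, THEN conjunct2, rule_format])

lemma add_right: "\<alpha> h (g + g') = \<alpha> h g * \<alpha> h g'"
  by (simp add: skew[of h] add_left)

lemma zero_left [simp]: "\<alpha> 0 h = 1"
  using add_left[of 0 0 h] by simp

lemma zero_right [simp]: "\<alpha> h 0 = 1"
  by (simp add: skew[of h])

lemma minus_left: "\<alpha> (- g) h = inverse (\<alpha> g h)"
  by (rule inverse_unique[symmetric]) (simp flip: add_left)

lemma minus_right: "\<alpha> h (- g) = inverse (\<alpha> h g)"
  by (rule inverse_unique[symmetric]) (simp flip: add_right)

lemma diag_square: "\<alpha> h h * \<alpha> h h = 1"
  by (rule skew_mult)

lemma A_pt_torus: "A_pt \<alpha> h \<in> torus"
  by (simp add: torus_def A_pt_def add_left)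

end

lemma alternating_pairing_triv: "alternating_pairing triv"
  by unfold_locales (simp add: alt_pairing_def triv_def)

lemma torus_one: "(\<lambda>_. 1) \<in> torus"
  by (simp add: torus_def)

lemma torus_mult: "x \<in> torus \<Longrightarrow> y \<in> torus \<Longrightarrow> (\<lambda>k. x k * y k) \<in> torus"
  by (simp add: torus_def)

lemma torus_inverse: "x \<in> torus \<Longrightarrow> (\<lambda>k. inverse (x k)) \<in> torus"
  by (simp add: torus_def)

lemma torus_nonzero: "x \<in> torus \<Longrightarrow> x k \<noteq> 0"
  by (simp add: torus_def)

lemma torus_add: "x \<in> torus \<Longrightarrow> x (g + h) = x g * x h"
  by (simp add: torus_def)

lemma torus_zero: "x \<in> torus \<Longrightarrow> x 0 = 1"
  using torus_add[of x 0 0] torus_nonzero[of x 0] by simp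

section \<open>The large Heisenberg group\<close>

context alternating_pairing
begin

lemma heis_tilde_group: "group (heis_tilde \<alpha>)"
proof (rule groupI)
  fix p q assume "p \<in> carrier (heis_tilde \<alpha>)" "q \<in> carrier (heis_tilde \<alpha>)"
  then show "p \<otimes>\<^bsub>heis_tilde \<alpha>\<^esub> q \<in> carrier (heis_tilde \<alpha>)"
    by (auto simp: heis_tilde_def torus_mult torus_nonzero)
next
  show "\<one>\<^bsub>heis_tilde \<alpha>\<^esub> \<in> carrier (heis_tilde \<alpha>)"
    by (simp add: heis_tilde_def torus_one)
next
  fix p q r
  assume "p \<in> carrier (heis_tilde \<alpha>)" "q \<in> carrier (heis_tilde \<alpha>)" "r \<in> carrier (heis_tilde \<alpha>)"
  then show "p \<otimes>\<^bsub>heis_tilde \<alpha>\<^esub> q \<otimes>\<^bsub>heis_tilde \<alpha>\<^esub> r = p \<otimes>\<^bsub>heis_tilde \<alpha>\<^esub> (q \<otimes>\<^bsub>heis_tilde \<alpha>\<^esub> r)"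
    by (auto simp: heis_tilde_def torus_add add_left add_right mult_ac add_ac)
next
  fix p assume "p \<in> carrier (heis_tilde \<alpha>)"
  then show "\<one>\<^bsub>heis_tilde \<alpha>\<^esub> \<otimes>\<^bsub>heis_tilde \<alpha>\<^esub> p = p"
    by (auto simp: heis_tilde_def)
next
  fix p assume "p \<in> carrier (heis_tilde \<alpha>)"
  then obtain c x g h where p: "p = (c, x, g, h)" "c \<noteq> 0" "x \<in> torus"
    by (auto simp: heis_tilde_def)
  let ?q = "(inverse c * x g * inverse (x h) * \<alpha> g g * inverse (\<alpha> h h),
             \<lambda>k. inverse (x k), - g, - h)"
  have "?q \<in> carrier (heis_tilde \<alpha>)"
    using p by (auto simp: heis_tilde_def torus_inverse torus_nonzero)
  moreover have "?q \<otimes>\<^bsub>heis_tilde \<alpha>\<^esub> p = \<one>\<^bsub>heis_tilde \<alpha>\<^esub>"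
    using p by (simp add: heis_tilde_def minus_left torus_nonzero field_simps)
  ultimately show "\<exists>q\<in>carrier (heis_tilde \<alpha>). q \<otimes>\<^bsub>heis_tilde \<alpha>\<^esub> p = \<one>\<^bsub>heis_tilde \<alpha>\<^esub>"
    by blast
qed

sublocale tilde: group "heis_tilde \<alpha>"
  by (rule heis_tilde_group)

lemma heis_tilde0_carrier:
  "(1, (\<lambda>g. (A_pt \<alpha> h g)\<^sup>2), h, h) \<in> carrier (heis_tilde \<alpha>)"
  using A_pt_torus[of h] by (simp add: heis_tilde_def power2_eq_square torus_mult)

text \<open>
  The factors \<open>A\<^sub>p(g)\<^sup>2 \<alpha>(p,g)\<close> of the multiplication law collapse to \<open>\<alpha>(g,p)\<close>, because
  \<open>A\<^sub>p(g) = \<alpha>(g,p)\<close> is inverse to \<open>\<alpha>(p,g)\<close>.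
\<close>

lemma heis_tilde0_mult:
  "(1, (\<lambda>g. (A_pt \<alpha> p g)\<^sup>2), p, p) \<otimes>\<^bsub>heis_tilde \<alpha>\<^esub> (c, x, g, h)
     = (c * \<alpha> g p * \<alpha> p h, (\<lambda>k. x k * (A_pt \<alpha> p k)\<^sup>2), p + g, p + h)"
  by (simp add: heis_tilde_def A_pt_def skew[of p] power2_eq_square field_simps)

lemma heis_tilde0_subgroup: "subgroup (heis_tilde0 \<alpha>) (heis_tilde \<alpha>)"
proof (rule tilde.subgroupI)
  show "heis_tilde0 \<alpha> \<subseteq> carrier (heis_tilde \<alpha>)"
    using heis_tilde0_carrier by (auto simp: heis_tilde0_def)
  show "heis_tilde0 \<alpha> \<noteq> {}"
    by (auto simp: heis_tilde0_def)
next
  fix a b assume "a \<in> heis_tilde0 \<alpha>" "b \<in> heis_tilde0 \<alpha>"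
  then obtain p q where ab: "a = (1, (\<lambda>g. (A_pt \<alpha> p g)\<^sup>2), p, p)"
      "b = (1, (\<lambda>g. (A_pt \<alpha> q g)\<^sup>2), q, q)"
    by (auto simp: heis_tilde0_def)
  have "a \<otimes>\<^bsub>heis_tilde \<alpha>\<^esub> b = (1, (\<lambda>g. (A_pt \<alpha> (p + q) g)\<^sup>2), p + q, p + q)"
    unfolding ab heis_tilde0_mult
    by (simp add: A_pt_def add_right power_mult_distrib mult.commute)
  then show "a \<otimes>\<^bsub>heis_tilde \<alpha>\<^esub> b \<in> heis_tilde0 \<alpha>"
    by (auto simp: heis_tilde0_def)
next
  fix a assume "a \<in> heis_tilde0 \<alpha>"
  then obtain p where a: "a = (1, (\<lambda>g. (A_pt \<alpha> p g)\<^sup>2), p, p)"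
    by (auto simp: heis_tilde0_def)
  let ?b = "(1, (\<lambda>g. (A_pt \<alpha> (- p) g)\<^sup>2), - p, - p)"
  have "?b \<otimes>\<^bsub>heis_tilde \<alpha>\<^esub> a = \<one>\<^bsub>heis_tilde \<alpha>\<^esub>"
    by (simp add: a heis_tilde0_mult)
       (simp add: heis_tilde_def A_pt_def minus_left minus_right field_simps)
  then have "inv\<^bsub>heis_tilde \<alpha>\<^esub> a = ?b"
    using heis_tilde0_carrier a by (intro tilde.inv_equality) auto
  then show "inv\<^bsub>heis_tilde \<alpha>\<^esub> a \<in> heis_tilde0 \<alpha>"
    by (auto simp: heis_tilde0_def)
qed

lemma heis_tilde0_central:
  assumes "a \<in> heis_tilde0 \<alpha>" "b \<in> carrier (heis_tilde \<alpha>)"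
  shows "a \<otimes>\<^bsub>heis_tilde \<alpha>\<^esub> b = b \<otimes>\<^bsub>heis_tilde \<alpha>\<^esub> a"
proof -
  obtain p where a: "a = (1, (\<lambda>g. (A_pt \<alpha> p g)\<^sup>2), p, p)"
    using assms(1) by (auto simp: heis_tilde0_def)
  obtain c x g h where b: "b = (c, x, g, h)" "c \<noteq> 0" "x \<in> torus"
    using assms(2) by (auto simp: heis_tilde_def)
  show ?thesis
    unfolding a b heis_tilde0_mult using b
    by (simp add: heis_tilde_def skew[of p] torus_nonzero ac_simps)
qed

lemma heis_tilde0_normal: "heis_tilde0 \<alpha> \<lhd> heis_tilde \<alpha>"
proof (rule tilde.normal_invI[OF heis_tilde0_subgroup])
  fix b a assume ab: "b \<in> carrier (heis_tilde \<alpha>)" "a \<in> heis_tilde0 \<alpha>"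
  then have a: "a \<in> carrier (heis_tilde \<alpha>)"
    using subgroup.mem_carrier[OF heis_tilde0_subgroup] by blast
  show "b \<otimes>\<^bsub>heis_tilde \<alpha>\<^esub> a \<otimes>\<^bsub>heis_tilde \<alpha>\<^esub> inv\<^bsub>heis_tilde \<alpha>\<^esub> b \<in> heis_tilde0 \<alpha>"
    using ab a by (simp add: heis_tilde0_central[symmetric] tilde.m_assoc)
qed

lemma heis_class_eq:
  "heis_class \<alpha> (c, x, g, h) =
     {(c * \<alpha> g p * \<alpha> p h, (\<lambda>k. x k * (A_pt \<alpha> p k)\<^sup>2), p + g, p + h) | p. True}"
  unfolding heis_class_def r_coset_def heis_tilde0_def heis_tilde0_mult[symmetric] by blast

text \<open>
  The last component of \<open>[1;A\<^sub>p\<^sup>2,p,p] [c;x,g,h]\<close> is \<open>p + h\<close>, so exactly one member of a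
  class, the one with \<open>p = -h\<close>, has last component \<open>0\<close>.
\<close>

lemma left_representative:
  assumes "\<Gamma> \<in> carrier (heis \<alpha>)"
  obtains c x h where "c \<noteq> 0" "x \<in> torus" "\<Gamma> = heis_class \<alpha> (c, x, h, 0)"
proof -
  obtain \<gamma> where \<gamma>: "\<gamma> \<in> carrier (heis_tilde \<alpha>)" "\<Gamma> = heis_class \<alpha> \<gamma>"
    using assms by (auto simp: heis_def FactGroup_def RCOSETS_def heis_class_def)
  obtain c x g h where gam: "\<gamma> = (c, x, g, h)" "c \<noteq> 0" "x \<in> torus"
    using \<gamma>(1) by (auto simp: heis_tilde_def)
  let ?\<delta> = "(c * \<alpha> g (- h) * \<alpha> (- h) h, (\<lambda>k. x k * (A_pt \<alpha> (- h) k)\<^sup>2), - h + g, 0)"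
  have "?\<delta> \<in> heis_class \<alpha> \<gamma>"
    unfolding gam heis_class_eq by (rule CollectI, rule exI[of _ "- h"]) simp
  then have "heis_class \<alpha> ?\<delta> = heis_class \<alpha> \<gamma>"
    unfolding heis_class_def
    using tilde.repr_independence[OF _ \<gamma>(1) heis_tilde0_subgroup] by simp
  moreover have "(\<lambda>k. x k * (A_pt \<alpha> (- h) k)\<^sup>2) \<in> torus"
    using gam A_pt_torus[of "- h"] by (simp add: power2_eq_square torus_mult)
  ultimately show thesis
    using gam \<gamma>(2)
    by (intro that[of "c * \<alpha> g (- h) * \<alpha> (- h) h" "\<lambda>k. x k * (A_pt \<alpha> (- h) k)\<^sup>2" "- h + g"])
      simp_all
qed

lemma left_representative_unique:
  assumes "heis_class \<alpha> (c, x, h, 0) = heis_class \<alpha> (c', x', h', 0)"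
  shows "c = c' \<and> x = x' \<and> h = h'"
proof -
  have "(c, x, h, 0) \<in> heis_class \<alpha> (c, x, h, 0)"
    unfolding heis_class_eq by (rule CollectI, rule exI[of _ 0]) (simp add: A_pt_def)
  then have "(c, x, h, 0) \<in> heis_class \<alpha> (c', x', h', 0)"
    using assms by simp
  then show ?thesis
    by (auto simp: heis_class_eq A_pt_def)
qed

lemma left_class_carrier:
  assumes "c \<noteq> 0" "x \<in> torus"
  shows "heis_class \<alpha> (c, x, h, 0) \<in> carrier (heis \<alpha>)"
  using assms by (auto simp: heis_def FactGroup_def RCOSETS_def heis_class_def heis_tilde_def)

lemma left_class_mult:
  assumes "c' \<noteq> 0" "x' \<in> torus" "c \<noteq> 0" "x \<in> torus"
  shows "heis_class \<alpha> (c', x', g', 0) \<otimes>\<^bsub>heis \<alpha>\<^esub> heis_class \<alpha> (c, x, g, 0)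
    = heis_class \<alpha> (c' * c * x' g * \<alpha> g' g, (\<lambda>k. x k * x' k), g' + g, 0)"
proof -
  have "heis_class \<alpha> (c', x', g', 0) \<otimes>\<^bsub>heis \<alpha>\<^esub> heis_class \<alpha> (c, x, g, 0)
    = heis_class \<alpha> ((c', x', g', 0) \<otimes>\<^bsub>heis_tilde \<alpha>\<^esub> (c, x, g, 0))"
    unfolding heis_class_def heis_def FactGroup_def monoid.simps
    using assms by (intro normal.rcos_sum[OF heis_tilde0_normal]) (auto simp: heis_tilde_def)
  also have "(c', x', g', 0) \<otimes>\<^bsub>heis_tilde \<alpha>\<^esub> (c, x, g, 0)
    = (c' * c * x' g * \<alpha> g' g, (\<lambda>k. x k * x' k), g' + g, 0)"
    using assms by (simp add: heis_tilde_def torus_zero add.commute)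
  finally show ?thesis .
qed

end

section \<open>The action on functions\<close>

lemma lmul_e_basis: "lmul \<alpha> (e_basis g) \<Psi> = (\<lambda>k. \<Psi> (k - g) * \<alpha> g (k - g))"
proof -
  have "{g'. e_basis g g' \<noteq> (0::'b)} = {g}"
    by (auto simp: e_basis_def)
  then show ?thesis
    by (simp add: lmul_def e_basis_def)
qed

lemma scaled_e_basis_support:
  "a \<noteq> 0 \<Longrightarrow> {h. a * e_basis g h \<noteq> (0::'k::field)} = {g}"
  by (auto simp: e_basis_def)

context alternating_pairing
begin

lemma inv_e_basis: "inv\<^bsub>Al \<alpha>\<^esub> (e_basis h) = (\<lambda>k. \<alpha> h h * e_basis (- h) k)"
proof -
  let ?y = "\<lambda>k. \<alpha> h h * e_basis (- h) k"
  have right: "lmul \<alpha> (e_basis h) ?y = e_basis 0"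
    unfolding lmul_e_basis by (rule ext) (auto simp: e_basis_def minus_right)
  have left: "lmul \<alpha> ?y (e_basis h) = e_basis 0"
    unfolding lmul_def scaled_e_basis_support[OF nonzero]
    by (rule ext) (auto simp: e_basis_def minus_left)
  \<comment> \<open>Left multiplication by \<open>e(h)\<close> is a translation up to nonzero factors, hence injective.\<close>
  have unique: "z = ?y" if "lmul \<alpha> (e_basis h) z = e_basis 0" for z
  proof
    fix k
    have "z k * \<alpha> h k = ?y k * \<alpha> h k"
      using fun_cong[OF that, of "k + h"] fun_cong[OF right, of "k + h"]
      by (simp add: lmul_e_basis)
    then show "z k = ?y k"
      by simp
  qed
  have finite_support: "finite {k. ?y k \<noteq> 0}"
    unfolding scaled_e_basis_support[OF nonzero] by simp
  show ?thesis
    unfolding m_inv_def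
  proof (rule the_equality)
    show "?y \<in> carrier (Al \<alpha>) \<and> e_basis h \<otimes>\<^bsub>Al \<alpha>\<^esub> ?y = \<one>\<^bsub>Al \<alpha>\<^esub> \<and>
      ?y \<otimes>\<^bsub>Al \<alpha>\<^esub> e_basis h = \<one>\<^bsub>Al \<alpha>\<^esub>"
      unfolding Al_def Al_space_def monoid.simps partial_object.simps mem_Collect_eq
      using finite_support left right by blast
  next
    fix z
    assume "z \<in> carrier (Al \<alpha>) \<and> e_basis h \<otimes>\<^bsub>Al \<alpha>\<^esub> z = \<one>\<^bsub>Al \<alpha>\<^esub> \<and>
      z \<otimes>\<^bsub>Al \<alpha>\<^esub> e_basis h = \<one>\<^bsub>Al \<alpha>\<^esub>"
    then have "lmul \<alpha> (e_basis h) z = e_basis 0"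
      by (simp add: Al_def)
    then show "z = ?y"
      by (rule unique)
  qed
qed

text \<open>
  The sign \<open>\<alpha>(h,h)\<close> in \<open>e(h)\<^sup>-\<^sup>1 = \<alpha>(h,h) e(-h)\<close> meets the same sign in
  \<open>\<alpha>(k+h,-h) = \<alpha>(h,k) \<alpha>(h,h)\<close>.
\<close>

lemma heis_tilde_act_eq:
  "heis_tilde_act \<alpha> (c, x, g, h) \<Phi> k
     = c * \<Phi> (k + h - g) * x (k + h - g) * \<alpha> g (k + h - g) * \<alpha> h k"
proof -
  have "\<alpha> h h * \<alpha> (k + h) (- h) = \<alpha> h k * (\<alpha> h h * \<alpha> h h)"
    unfolding minus_right skew[symmetric] add_right by (simp only: mult_ac)
  then have "\<alpha> h h * \<alpha> (k + h) (- h) = \<alpha> h k"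
    by (simp add: diag_square)
  then show ?thesis
    unfolding heis_tilde_act_def inv_e_basis rmul_def scaled_e_basis_support[OF nonzero]
      lmul_e_basis shift_def
    by (simp add: e_basis_def mult.assoc)
qed

text \<open>
  Multiplying a representative by \<open>[1;A\<^sub>p\<^sup>2,p,p]\<close> leaves \<open>m = k + h - g\<close> unchanged and
  contributes the factor \<open>\<alpha>(g,p) \<alpha>(p,h) \<alpha>(m,p) \<alpha>(p,k) = \<alpha>(p, h - g - m + k) = 1\<close>.
\<close>

lemma heis_tilde_act_class:
  assumes "\<gamma> \<in> heis_class \<alpha> (c, x, g, h)"
  shows "heis_tilde_act \<alpha> \<gamma> \<Phi> = heis_tilde_act \<alpha> (c, x, g, h) \<Phi>"
proof -
  obtain p where \<gamma>:
    "\<gamma> = (c * \<alpha> g p * \<alpha> p h, (\<lambda>k. x k * (A_pt \<alpha> p k)\<^sup>2), p + g, p + h)"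
    using assms by (auto simp: heis_class_eq)
  show ?thesis
  proof
    fix k
    define m where "m = k + h - g"
    have m: "k + (p + h) - (p + g) = m"
      by (simp add: m_def algebra_simps)
    have "\<alpha> p k * \<alpha> p h = \<alpha> p m * \<alpha> p g"
      unfolding add_right[symmetric] by (simp add: m_def)
    moreover have "\<alpha> g p * \<alpha> p h * (\<alpha> m p * \<alpha> m p) * \<alpha> p m * \<alpha> p k
        = (\<alpha> p k * \<alpha> p h) * (\<alpha> g p * (\<alpha> m p * \<alpha> m p) * \<alpha> p m)"
      by (simp only: mult_ac)
    moreover have "(\<alpha> p m * \<alpha> p g) * (\<alpha> g p * (\<alpha> m p * \<alpha> m p) * \<alpha> p m)
        = (\<alpha> g p * \<alpha> p g) * (\<alpha> m p * \<alpha> p m) * (\<alpha> m p * \<alpha> p m)"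
      by (simp only: mult_ac)
    ultimately have "\<alpha> g p * \<alpha> p h * (\<alpha> m p * \<alpha> m p) * \<alpha> p m * \<alpha> p k = 1"
      by (simp only: skew_mult mult_1)
    moreover have "heis_tilde_act \<alpha> \<gamma> \<Phi> k
        = (c * \<Phi> m * x m * \<alpha> g m * \<alpha> h k)
          * (\<alpha> g p * \<alpha> p h * (\<alpha> m p * \<alpha> m p) * \<alpha> p m * \<alpha> p k)"
      unfolding \<gamma> heis_tilde_act_eq m
      by (simp only: A_pt_def power2_eq_square add_left mult_ac)
    ultimately show "heis_tilde_act \<alpha> \<gamma> \<Phi> k = heis_tilde_act \<alpha> (c, x, g, h) \<Phi> k"
      by (simp add: heis_tilde_act_eq m_def)
  qed
qed

lemma heis_act_left_class:
  "heis_act \<alpha> (heis_class \<alpha> (c, x, h, 0)) \<Phi>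
     = (\<lambda>k. c * \<Phi> (k - h) * x (k - h) * \<alpha> h (k - h))"
proof -
  let ?C = "heis_class \<alpha> (c, x, h, 0)" and ?\<Psi> = "heis_tilde_act \<alpha> (c, x, h, 0) \<Phi>"
  have "?C \<noteq> {}"
    by (auto simp: heis_class_eq)
  moreover have "(\<lambda>\<gamma>. heis_tilde_act \<alpha> \<gamma> \<Phi>) ` ?C = (\<lambda>_. ?\<Psi>) ` ?C"
    by (rule image_cong[OF refl heis_tilde_act_class])
  ultimately have "(\<lambda>\<gamma>. heis_tilde_act \<alpha> \<gamma> \<Phi>) ` ?C = {?\<Psi>}"
    by (simp add: image_constant_conv)
  then show ?thesis
    by (auto simp: heis_act_def heis_tilde_act_eq)
qed

text \<open>
  The operator \<open>[c;x,h,0]\<close> sends \<open>e(0)\<close> to \<open>c e(h)\<close> and \<open>e(m)\<close> to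
  \<open>c x(m) \<alpha>(h,m) e(h+m)\<close>, so its values on basis elements determine \<open>h\<close>, \<open>c\<close> and \<open>x\<close>.
\<close>

lemma heis_act_faithful:
  assumes \<Gamma>: "\<Gamma> \<in> carrier (heis \<alpha>)" and \<Delta>: "\<Delta> \<in> carrier (heis \<alpha>)"
    and eq: "\<And>m. heis_act \<alpha> \<Gamma> (e_basis m) = heis_act \<alpha> \<Delta> (e_basis m)"
  shows "\<Gamma> = \<Delta>"
proof -
  obtain c x h where 1: "c \<noteq> 0" "x \<in> torus" "\<Gamma> = heis_class \<alpha> (c, x, h, 0)"
    using left_representative[OF \<Gamma>] by blast
  obtain d y g where 2: "d \<noteq> 0" "y \<in> torus" "\<Delta> = heis_class \<alpha> (d, y, g, 0)"
    using left_representative[OF \<Delta>] by blast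
  have vals: "c * e_basis m (k - h) * x (k - h) * \<alpha> h (k - h)
      = d * e_basis m (k - g) * y (k - g) * \<alpha> g (k - g)" for m k
    using fun_cong[OF eq[of m], of k] by (simp add: 1 2 heis_act_left_class)
  have [simp]: "g = h"
    using vals[of 0 h] 1 by (auto simp: e_basis_def torus_zero split: if_splits)
  have [simp]: "d = c"
    using vals[of 0 h] 1 2 by (simp add: e_basis_def torus_zero)
  have "x m = y m" for m
    using vals[of m "m + h"] 1 by (simp add: e_basis_def)
  then have "x = y" ..
  then show ?thesis
    by (simp add: 1 2)
qed

end

section \<open>The isomorphism\<close>

context alternating_pairing
begin

interpretation triv: alternating_pairing triv
  by (rule alternating_pairing_triv)

lemma u_grp_left_class:
  assumes "c \<noteq> 0" "x \<in> torus"
  shows "u_grp \<alpha> (heis_class triv (c, x, h, 0))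
    = heis_class \<alpha> (c, (\<lambda>g. x g * A_pt \<alpha> h g), h, 0)"
  unfolding u_grp_def
proof (rule the_equality)
  show "\<exists>c' x' h'. c' \<noteq> 0 \<and> x' \<in> torus \<and>
      heis_class triv (c, x, h, 0) = heis_class triv (c', x', h', 0) \<and>
      heis_class \<alpha> (c, (\<lambda>g. x g * A_pt \<alpha> h g), h, 0)
        = heis_class \<alpha> (c', (\<lambda>g. x' g * A_pt \<alpha> h' g), h', 0)"
    using assms by blast
qed (use triv.left_representative_unique in blast)

lemma u_grp_carrier:
  assumes "\<Gamma> \<in> carrier (heis triv)"
  shows "u_grp \<alpha> \<Gamma> \<in> carrier (heis \<alpha>)"
proof -
  obtain c x h where "c \<noteq> 0" "x \<in> torus" "\<Gamma> = heis_class triv (c, x, h, 0)"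
    using triv.left_representative[OF assms] by blast
  then show ?thesis
    by (simp add: u_grp_left_class left_class_carrier torus_mult A_pt_torus)
qed

text \<open>
  The shift by \<open>A\<^sub>g\<^sub>'\<close> contributes \<open>\<alpha>(g,g')\<close>, which cancels the factor \<open>\<alpha>(g',g)\<close> of the
  group law.
\<close>

lemma u_grp_mult:
  assumes "\<Gamma> \<in> carrier (heis triv)" "\<Delta> \<in> carrier (heis triv)"
  shows "u_grp \<alpha> (\<Gamma> \<otimes>\<^bsub>heis triv\<^esub> \<Delta>) = u_grp \<alpha> \<Gamma> \<otimes>\<^bsub>heis \<alpha>\<^esub> u_grp \<alpha> \<Delta>"
proof -
  obtain c' x' g' where 1: "c' \<noteq> 0" "x' \<in> torus" "\<Gamma> = heis_class triv (c', x', g', 0)"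
    using triv.left_representative[OF assms(1)] by blast
  obtain c x g where 2: "c \<noteq> 0" "x \<in> torus" "\<Delta> = heis_class triv (c, x, g, 0)"
    using triv.left_representative[OF assms(2)] by blast
  have "u_grp \<alpha> (\<Gamma> \<otimes>\<^bsub>heis triv\<^esub> \<Delta>)
      = heis_class \<alpha> (c' * c * x' g, (\<lambda>k. x k * x' k * A_pt \<alpha> (g' + g) k), g' + g, 0)"
    using 1 2 by (simp add: triv.left_class_mult u_grp_left_class torus_mult torus_nonzero)
      (simp add: triv_def u_grp_left_class torus_mult torus_nonzero)
  also have "\<dots> = u_grp \<alpha> \<Gamma> \<otimes>\<^bsub>heis \<alpha>\<^esub> u_grp \<alpha> \<Delta>"
    using 1 2
    by (simp add: u_grp_left_class left_class_mult torus_mult A_pt_torus)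
      (simp add: A_pt_def add_right mult_ac)
  finally show ?thesis .
qed

lemma u_grp_bij: "bij_betw (u_grp \<alpha>) (carrier (heis triv)) (carrier (heis \<alpha>))"
proof (rule bij_betw_imageI)
  show "inj_on (u_grp \<alpha>) (carrier (heis triv))"
  proof (rule inj_onI)
    fix \<Gamma> \<Delta> assume \<Gamma>: "\<Gamma> \<in> carrier (heis triv)" and \<Delta>: "\<Delta> \<in> carrier (heis triv)"
      and eq: "u_grp \<alpha> \<Gamma> = u_grp \<alpha> \<Delta>"
    obtain c x h where 1: "c \<noteq> 0" "x \<in> torus" "\<Gamma> = heis_class triv (c, x, h, 0)"
      using triv.left_representative[OF \<Gamma>] by blast
    obtain d y g where 2: "d \<noteq> 0" "y \<in> torus" "\<Delta> = heis_class triv (d, y, g, 0)"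
      using triv.left_representative[OF \<Delta>] by blast
    have "heis_class \<alpha> (c, (\<lambda>k. x k * A_pt \<alpha> h k), h, 0)
        = heis_class \<alpha> (d, (\<lambda>k. y k * A_pt \<alpha> g k), g, 0)"
      using eq 1 2 by (simp add: u_grp_left_class)
    then have *: "c = d" "h = g" "(\<lambda>k. x k * A_pt \<alpha> h k) = (\<lambda>k. y k * A_pt \<alpha> h k)"
      using left_representative_unique by blast+
    have "x k = y k" for k
      using fun_cong[OF *(3), of k] by (simp add: A_pt_def)
    then have "x = y" ..
    then show "\<Gamma> = \<Delta>"
      using 1 2 * by simp
  qed
  show "u_grp \<alpha> ` carrier (heis triv) = carrier (heis \<alpha>)"
  proof
    show "u_grp \<alpha> ` carrier (heis triv) \<subseteq> carrier (heis \<alpha>)"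
      using u_grp_carrier by blast
    show "carrier (heis \<alpha>) \<subseteq> u_grp \<alpha> ` carrier (heis triv)"
    proof
      fix \<Delta> assume "\<Delta> \<in> carrier (heis \<alpha>)"
      then obtain c y h where 1: "c \<noteq> 0" "y \<in> torus" "\<Delta> = heis_class \<alpha> (c, y, h, 0)"
        by (rule left_representative)
      define x where "x = (\<lambda>k. y k * inverse (A_pt \<alpha> h k))"
      have x: "x \<in> torus"
        unfolding x_def by (intro torus_mult torus_inverse A_pt_torus 1)
      have "(\<lambda>k. x k * A_pt \<alpha> h k) = y"
        by (simp add: x_def A_pt_def mult.assoc)
      then have "u_grp \<alpha> (heis_class triv (c, x, h, 0)) = \<Delta>"
        using 1 x by (simp add: u_grp_left_class)
      then show "\<Delta> \<in> u_grp \<alpha> ` carrier (heis triv)"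
        using triv.left_class_carrier[OF 1(1) x] by blast
    qed
  qed
qed

lemma u_grp_iso: "u_grp \<alpha> \<in> iso (heis triv) (heis \<alpha>)"
  by (auto simp: iso_def hom_def u_grp_mult u_grp_carrier u_grp_bij)

lemma heis_act_u_grp:
  assumes "\<Gamma> \<in> carrier (heis triv)"
  shows "heis_act \<alpha> (u_grp \<alpha> \<Gamma>) \<Phi> = heis_act triv \<Gamma> \<Phi>"
proof -
  obtain c x h where \<Gamma>: "c \<noteq> 0" "x \<in> torus" "\<Gamma> = heis_class triv (c, x, h, 0)"
    using triv.left_representative[OF assms] by blast
  show ?thesis
    unfolding \<Gamma>(3) u_grp_left_class[OF \<Gamma>(1,2)] heis_act_left_class triv.heis_act_left_class
    by (simp add: A_pt_def triv_def mult.assoc)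
qed

lemma u_grp_intertwines: "intertwines \<alpha> V (u_grp \<alpha>) u_fun"
  by (simp add: intertwines_def u_fun_def heis_act_u_grp)

lemma u_grp_unique:
  assumes f: "f \<in> iso (heis triv) (heis \<alpha>)"
    and int: "intertwines \<alpha> (carrier (Al triv)) f u_fun"
    and \<Gamma>: "\<Gamma> \<in> carrier (heis triv)"
  shows "f \<Gamma> = u_grp \<alpha> \<Gamma>"
proof (rule heis_act_faithful)
  show "f \<Gamma> \<in> carrier (heis \<alpha>)"
    using f \<Gamma> by (auto simp: iso_def hom_def)
  show "u_grp \<alpha> \<Gamma> \<in> carrier (heis \<alpha>)"
    by (rule u_grp_carrier[OF \<Gamma>])
  fix m :: 'h
  have "e_basis m \<in> carrier (Al triv)"
    by (simp add: Al_def Al_space_def e_basis_def)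
  then have "heis_act triv \<Gamma> (e_basis m) = heis_act \<alpha> (f \<Gamma>) (e_basis m)"
    using int \<Gamma> unfolding intertwines_def u_fun_def by blast
  then show "heis_act \<alpha> (f \<Gamma>) (e_basis m) = heis_act \<alpha> (u_grp \<alpha> \<Gamma>) (e_basis m)"
    by (simp add: heis_act_u_grp[OF \<Gamma>])
qed

end

lemma lin_iso_on_u_fun: "lin_iso_on V V u_fun"
  by (auto simp: lin_iso_on_def u_fun_def bij_betw_def inj_on_def)

theorem proposition1p2p1:
  fixes \<alpha> :: "'h::ab_group_add \<Rightarrow> 'h \<Rightarrow> 'k::field"
  assumes "free_abelian_finite_rank TYPE('h)"
    and "alt_pairing \<alpha>"
  shows
    \<comment> \<open>(a)\<close>
    "(\<forall>c x h. c \<noteq> 0 \<and> x \<in> torus \<longrightarrow>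
        u_grp \<alpha> (heis_class triv (c, x, h, 0))
          = heis_class \<alpha> (c, (\<lambda>g. x g * A_pt \<alpha> h g), h, 0))
     \<and> u_grp \<alpha> \<in> iso (heis triv) (heis \<alpha>)
    \<comment> \<open>(b)\<close>
     \<and> (\<forall>h::'h. u_fun (e_basis h :: 'h \<Rightarrow> 'k) = e_basis h)
     \<and> lin_iso_on (carrier (Al (triv :: 'h \<Rightarrow> 'h \<Rightarrow> 'k))) (carrier (Al \<alpha>)) u_fun
     \<and> intertwines \<alpha> (carrier (Al (triv :: 'h \<Rightarrow> 'h \<Rightarrow> 'k))) (u_grp \<alpha>) u_fun
     \<and> lin_iso_on (Af_space :: ('h \<Rightarrow> 'k) set) Af_space u_fun
     \<and> intertwines \<alpha> Af_space (u_grp \<alpha>) u_fun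
     \<and> (\<forall>v nm. complete_abs_value v \<and> unitary_pairing v \<alpha> \<and> euclidean_norm_on nm \<longrightarrow>
          lin_iso_on (An_space v nm :: ('h \<Rightarrow> 'k) set) (An_space v nm) u_fun \<and>
          intertwines \<alpha> (An_space v nm) (u_grp \<alpha>) u_fun)
    \<comment> \<open>(c)\<close>
     \<and> (\<forall>f \<in> iso (heis triv) (heis \<alpha>).
          intertwines \<alpha> (carrier (Al (triv :: 'h \<Rightarrow> 'h \<Rightarrow> 'k))) f u_fun \<longrightarrow>
          (\<forall>\<Gamma> \<in> carrier (heis triv). f \<Gamma> = u_grp \<alpha> \<Gamma>))"
proof -
  interpret alternating_pairing \<alpha>
    using assms(2) by unfold_locales
  have carrier_Al: "carrier (Al \<alpha>) = carrier (Al triv)"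
    by (simp add: Al_def)
  show ?thesis
    unfolding carrier_Al
  proof (intro conjI allI impI ballI)
    fix c :: 'k and x :: "'h \<Rightarrow> 'k" and h :: 'h
    assume "c \<noteq> 0 \<and> x \<in> torus"
    then show "u_grp \<alpha> (heis_class triv (c, x, h, 0))
        = heis_class \<alpha> (c, (\<lambda>g. x g * A_pt \<alpha> h g), h, 0)"
      by (intro u_grp_left_class) auto
  next
    show "u_fun (e_basis h :: 'h \<Rightarrow> 'k) = e_basis h" for h
      by (simp add: u_fun_def)
  qed (rule u_grp_iso lin_iso_on_u_fun u_grp_intertwines u_grp_unique; assumption)+
qed

end
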